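(* Let $n\geq 6$ be an even integer, let $1\leq p\leq \frac{n-4}{2}$ be an integer and let $e=\binom{n}{2}-\left(\frac{n+2}{2}+p\right)$. Then $$\rho_{min}(n,e)=\frac{n-5+\sqrt{(n+1)^2-8p-8}}{2},$$ and the minimizers of $\mathcal{G}_{n,e}$ are of the form $G^2_{n-2p-2}\vee G^3_{2p+2}$, i.e. the join of an $(n-2p-4)$-regular graph on $n-2p-2$ vertices with a $(2p-1)$-regular graph on $2p+2$ vertices.
   Context: All graphs are finite, simple and undirected. $\mathcal{G}_{n,e}$ is the set of all connected simple graphs on $n$ vertices with $e$ edges; $\rho(G)$ is the largest eigenvalue of the adjacency matrix of $G$; $\rho_{min}(n,e)=\min\{\rho(G):G\in\mathcal{G}_{n,e}\}$ and a minimizer of $\mathcal{G}_{n,e}$ is a graph in $\mathcal{G}_{n,e}$ attaining it. For natural numbers $m,r$, $G^r_m$ denotes an $(m-r)$-regular graph on $m$ vertices. The join $G\vee H$ of vertex-disjoint graphs is obtained from their disjoint union by adding all edges between vertices of $G$ and vertices of $H$. *)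

theory Defs
  imports
    "Jordan_Normal_Form.Char_Poly"
    "Graph_Theory.Pair_Digraph"
    "Graph_Theory.Digraph_Component"
begin

text \<open>
  A finite simple undirected graph is a \<open>pair_graph\<close>: a finite, loop-free digraph without
  parallel arcs whose arc relation is symmetric. Every undirected edge is thus represented by two
  opposite arcs, so the number of edges is the cardinality of the following set, not that of
  \<open>parcs G\<close>; likewise the degree of a vertex is its \<open>out_degree\<close>.
\<close>

definition edge_set :: "'a pair_pre_digraph \<Rightarrow> 'a set set" where
  "edge_set G = {{u, v} | u v. (u, v) \<in> parcs G}"

text \<open>
  Graphs on \<open>n\<close> vertices are labelled by \<open>{0..<n}\<close>, so that \<open>conn_graphs n e\<close> is a finite set
  containing a copy of every connected graph with \<open>n\<close> vertices and \<open>e\<close> edges, and the adjacency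
  matrix needs no choice of an enumeration of the vertices.
\<close>

definition conn_graphs :: "nat \<Rightarrow> nat \<Rightarrow> nat pair_pre_digraph set" where
  "conn_graphs n e =
    {G. pair_graph G \<and> pverts G = {0..<n} \<and> Digraph_Component.connected (with_proj G)
      \<and> card (edge_set G) = e}"

text \<open>Meaningful only for graphs whose vertex set is an initial segment \<open>{0..<n}\<close>.\<close>

definition adjacency_mat :: "nat pair_pre_digraph \<Rightarrow> real mat" where
  "adjacency_mat G =
    (let n = card (pverts G) in mat n n (\<lambda>(i, j). if (i, j) \<in> parcs G then 1 else 0))"

definition rho :: "nat pair_pre_digraph \<Rightarrow> real" where
  "rho G = Max {k. eigenvalue (adjacency_mat G) k}"

definition rho_min :: "nat \<Rightarrow> nat \<Rightarrow> real" where
  "rho_min n e = Min (rho ` conn_graphs n e)"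

definition minimizers :: "nat \<Rightarrow> nat \<Rightarrow> nat pair_pre_digraph set" where
  "minimizers n e = {G \<in> conn_graphs n e. rho G = rho_min n e}"

text \<open>\<open>coregular_graph m r H\<close>: \<open>H\<close> is an \<open>(m - r)\<close>-regular graph on \<open>m\<close> vertices.\<close>

definition coregular_graph :: "nat \<Rightarrow> nat \<Rightarrow> 'a pair_pre_digraph \<Rightarrow> bool" where
  "coregular_graph m r H \<longleftrightarrow>
    pair_graph H \<and> card (pverts H) = m \<and> r \<le> m
      \<and> (\<forall>v \<in> pverts H. out_degree (with_proj H) v = m - r)"

text \<open>The join; only used for graphs with disjoint vertex sets.\<close>

definition graph_join ::
  "'a pair_pre_digraph \<Rightarrow> 'a pair_pre_digraph \<Rightarrow> 'a pair_pre_digraph" where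
  "graph_join G H =
    \<lparr> pverts = pverts G \<union> pverts H,
      parcs = parcs G \<union> parcs H \<union> pverts G \<times> pverts H \<union> pverts H \<times> pverts G \<rparr>"

text \<open>The following two facts show that the maximum and the minimum above range over finite sets.\<close>

lemma finite_adjacency_eigenvalues: "finite {k. eigenvalue (adjacency_mat G) k}"
proof -
  let ?n = "card (pverts G)"
  have A: "adjacency_mat G \<in> carrier_mat ?n ?n"
    by (simp add: adjacency_mat_def Let_def)
  have "char_poly (adjacency_mat G) \<noteq> 0"
    using degree_monic_char_poly[OF A] by auto
  then show ?thesis
    using poly_roots_finite by (simp add: eigenvalue_root_char_poly[OF A])
qed

lemma finite_conn_graphs: "finite (conn_graphs n e)"
proof -
  have "conn_graphs n e \<subseteq>
      (\<lambda>R. \<lparr>pverts = {0..<n}, parcs = R\<rparr>) ` Pow ({0..<n} \<times> {0..<n})"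
  proof
    fix G assume G: "G \<in> conn_graphs n e"
    then interpret pair_graph G by (simp add: conn_graphs_def)
    have V: "pverts G = {0..<n}" using G by (simp add: conn_graphs_def)
    then have "parcs G \<subseteq> {0..<n} \<times> {0..<n}"
      using in_arcsD1 in_arcsD2 by auto
    moreover have "G = \<lparr>pverts = {0..<n}, parcs = parcs G\<rparr>" using V by simp
    ultimately show "G \<in> (\<lambda>R. \<lparr>pverts = {0..<n}, parcs = R\<rparr>) ` Pow ({0..<n} \<times> {0..<n})"
      by blast
  qed
  then show ?thesis by (rule finite_subset) simp
qed

end

theory Submission
  imports Defs "HOL-Analysis.Function_Topology"
begin

text \<open>
  Write \<open>d v\<close> for the degree of \<open>v\<close> in the complement of \<open>G\<close> and \<open>E\<close> for the set of nonadjacent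
  pairs. For the test vector \<open>x v = 1 / (l + 1 + d v)\<close>, with \<open>l\<close> the claimed minimum and \<open>T\<close> the
  sum of the entries of \<open>x\<close>, the adjacency form at \<open>x\<close> minus \<open>l\<close> times the squared norm of \<open>x\<close> is
  \<open>T * (T - 1)\<close> plus the sum of \<open>(x u - x v)\<^sup>2\<close> over \<open>E\<close>. The mean of \<open>d\<close> lies between \<open>1\<close> and \<open>2\<close>,
  so convexity gives \<open>T \<ge> 1\<close>, and by the Rayleigh principle \<open>rho G \<ge> l\<close>. Equality forces
  \<open>d v \<in> {1, 2}\<close> with \<open>d\<close> constant along nonadjacent pairs: the complement is then a perfect
  matching together with a 2-regular graph, and \<open>x\<close> is a positive eigenvector for \<open>l\<close>.
\<close>

section \<open>Rayleigh principle for real symmetric forms\<close>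

text \<open>Vectors are functions on \<open>nat\<close>, so compactness comes from a product: the
  first \<open>n\<close> coordinates range over \<open>{-1..1}\<close>, all others are pinned to
  \<open>0\<close>, and the unit sphere is cut out as a closed subset.\<close>

lemma quadratic_form_attains_sup_on_sphere:
  fixes a :: "nat \<Rightarrow> nat \<Rightarrow> real"
  assumes "n > 0"
  obtains x where "(\<Sum>i<n. (x i)\<^sup>2) = 1"
    and "\<And>y. (\<Sum>i<n. (y i)\<^sup>2) = 1 \<Longrightarrow>
      (\<Sum>i<n. \<Sum>j<n. a i j * y i * y j) \<le> (\<Sum>i<n. \<Sum>j<n. a i j * x i * x j)"
proof -
  define B :: "nat \<Rightarrow> real set" where "B i = (if i < n then {-1..1} else {0})" for i
  define S where "S = PiE UNIV B \<inter> {x. (\<Sum>i<n. (x i)\<^sup>2) = 1}"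
  have "compact (PiE UNIV B)"
    by (simp flip: compactin_euclidean_iff euclidean_product_topology add: compactin_PiE)
      (auto simp: B_def)
  moreover have "closed {x. (\<Sum>i<n. (x i)\<^sup>2) = (1 :: real)}"
    by (intro closed_Collect_eq continuous_intros continuous_on_product_coordinates)
  ultimately have "compact S"
    unfolding S_def by (rule compact_Int_closed)
  \<comment> \<open>The first unit vector shows that \<open>S\<close> is nonempty; this is where
    \<open>n > 0\<close> enters.\<close>
  moreover have "(\<lambda>i. if i = 0 then 1 else 0) \<in> S"
    using assms by (auto simp: S_def B_def PiE_def if_distrib[of "\<lambda>t. t\<^sup>2"] cong: if_cong)
  moreover have "continuous_on S (\<lambda>x. \<Sum>i<n. \<Sum>j<n. a i j * x i * x j)"
    by (intro continuous_intros
        continuous_on_subset[OF continuous_on_product_coordinates]) auto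
  ultimately obtain x where x: "x \<in> S"
    and max: "\<And>y. y \<in> S \<Longrightarrow>
      (\<Sum>i<n. \<Sum>j<n. a i j * y i * y j) \<le> (\<Sum>i<n. \<Sum>j<n. a i j * x i * x j)"
    using continuous_attains_sup[of S "\<lambda>x. \<Sum>i<n. \<Sum>j<n. a i j * x i * x j"] by blast
  show thesis
  proof (rule that)
    show "(\<Sum>i<n. (x i)\<^sup>2) = 1" using x by (simp add: S_def)
    fix y :: "nat \<Rightarrow> real" assume y: "(\<Sum>i<n. (y i)\<^sup>2) = 1"
    have "\<bar>y i\<bar> \<le> 1" if "i < n" for i
    proof -
      have "(y i)\<^sup>2 \<le> (\<Sum>i<n. (y i)\<^sup>2)" using that by (intro member_le_sum) auto
      with y show ?thesis by (simp add: abs_square_le_1)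
    qed
    \<comment> \<open>The form and the norm see only coordinates below \<open>n\<close>, so
      \<open>y\<close> may be replaced by its truncation, which lies in \<open>S\<close>.\<close>
    then have "(\<lambda>i. if i < n then y i else 0) \<in> S"
      using y by (auto simp: S_def B_def PiE_def abs_le_iff)
    from max[OF this]
    show "(\<Sum>i<n. \<Sum>j<n. a i j * y i * y j) \<le> (\<Sum>i<n. \<Sum>j<n. a i j * x i * x j)"
      by simp
  qed
qed

text \<open>A maximizer \<open>x\<close> of the form on the unit sphere is an eigenvector for the
  maximum \<open>m\<close>, and scaling extends the bound to all vectors. The eigenvalue equation
  follows by perturbing \<open>x\<close> along its own residual.\<close>

lemma symmetric_form_rayleigh:
  fixes a :: "nat \<Rightarrow> nat \<Rightarrow> real"
  assumes "n > 0" and sym: "\<And>i j. i < n \<Longrightarrow> j < n \<Longrightarrow> a i j = a j i"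
  obtains m x where "\<exists>i<n. x i \<noteq> 0"
    and "\<And>i. i < n \<Longrightarrow> (\<Sum>j<n. a i j * x j) = m * x i"
    and "\<And>y. (\<Sum>i<n. \<Sum>j<n. a i j * y i * y j) \<le> m * (\<Sum>i<n. (y i)\<^sup>2)"
proof -
  define Q where "Q y = (\<Sum>i<n. \<Sum>j<n. a i j * y i * y j)" for y
  define N where "N y = (\<Sum>i<n. (y i)\<^sup>2)" for y :: "nat \<Rightarrow> real"
  obtain x where x1: "N x = 1" and max: "\<And>y. N y = 1 \<Longrightarrow> Q y \<le> Q x"
    unfolding Q_def N_def
    by (rule quadratic_form_attains_sup_on_sphere[OF \<open>n > 0\<close>, of a]) iprover
  define m where "m = Q x"
  have bound: "Q y \<le> m * N y" for y
  proof (cases "N y = 0")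
    case True
    then have "\<And>i. i < n \<Longrightarrow> y i = 0" by (auto simp: N_def sum_nonneg_eq_0_iff)
    then show ?thesis by (simp add: Q_def N_def)
  next
    case False
    then have pos: "N y > 0" using sum_nonneg[of "{..<n}" "\<lambda>i. (y i)\<^sup>2"] by (simp add: N_def)
    have "N (\<lambda>i. y i / sqrt (N y)) = N y / N y"
      using pos by (simp add: power_divide N_def flip: sum_divide_distrib)
    with pos have "Q (\<lambda>i. y i / sqrt (N y)) \<le> m" unfolding m_def by (intro max) simp
    moreover have "Q (\<lambda>i. y i / sqrt (N y)) = Q y / N y"
      using pos by (simp add: Q_def sum_divide_distrib)
    ultimately show ?thesis using pos by (simp add: field_simps)
  qed
  \<comment> \<open>The residual serves as direction: \<open>m * N - Q\<close> is nonnegative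
    everywhere, vanishes at \<open>x\<close>, and has linear term \<open>2 * t * N g\<close> along
    \<open>g\<close>.\<close>
  define g where "g i = m * x i - (\<Sum>j<n. a i j * x j)" for i
  define C where "C = m * N g - Q g"
  have quad: "0 \<le> 2 * t * N g + t\<^sup>2 * C" for t
  proof -
    have swap: "(\<Sum>i<n. \<Sum>j<n. a i j * x i * g j) = (\<Sum>i<n. \<Sum>j<n. a i j * g i * x j)"
      by (subst sum.swap) (auto intro!: sum.cong simp: sym)
    have "Q (\<lambda>i. x i + t * g i) = (\<Sum>i<n. \<Sum>j<n. a i j * x i * x j
        + t * (a i j * x i * g j) + t * (a i j * g i * x j) + t\<^sup>2 * (a i j * g i * g j))"
      unfolding Q_def by (intro sum.cong refl) (simp add: algebra_simps power2_eq_square)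
    also have "\<dots> = Q x + t * (\<Sum>i<n. \<Sum>j<n. a i j * x i * g j)
        + t * (\<Sum>i<n. \<Sum>j<n. a i j * g i * x j) + t\<^sup>2 * Q g"
      by (simp only: Q_def sum_distrib_left sum.distrib)
    finally have "Q (\<lambda>i. x i + t * g i) = Q x + t * (\<Sum>i<n. \<Sum>j<n. a i j * x i * g j)
        + t * (\<Sum>i<n. \<Sum>j<n. a i j * g i * x j) + t\<^sup>2 * Q g" .
    moreover have "N (\<lambda>i. x i + t * g i) = N x + 2 * t * (\<Sum>i<n. x i * g i) + t\<^sup>2 * N g"
      unfolding N_def sum_distrib_left sum.distrib[symmetric]
      by (intro sum.cong refl) (simp add: algebra_simps power2_eq_square)
    moreover have "N g = m * (\<Sum>i<n. x i * g i) - (\<Sum>i<n. \<Sum>j<n. a i j * g i * x j)"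
    proof -
      have "(g i)\<^sup>2 = m * (x i * g i) - (\<Sum>j<n. a i j * g i * x j)" for i
      proof -
        have "(g i)\<^sup>2 = g i * (m * x i - (\<Sum>j<n. a i j * x j))"
          by (simp add: power2_eq_square flip: g_def)
        then show ?thesis by (simp add: right_diff_distrib sum_distrib_left mult_ac)
      qed
      then show ?thesis by (simp add: N_def sum_subtractf sum_distrib_left)
    qed
    moreover define X W where "X = (\<Sum>i<n. x i * g i)"
      and "W = (\<Sum>i<n. \<Sum>j<n. a i j * g i * x j)"
    ultimately have "m + 2 * t * W + t\<^sup>2 * Q g \<le> m * (1 + 2 * t * X + t\<^sup>2 * N g)"
      and W: "W = m * X - N g"
      using bound[of "\<lambda>i. x i + t * g i"] x1 swap by (simp_all add: m_def)
    then show ?thesis unfolding W C_def by (simp add: algebra_simps)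
  qed
  have "N g = 0"
  proof (rule ccontr)
    assume "N g \<noteq> 0"
    \<comment> \<open>As \<open>K > 0\<close> and \<open>K > C\<close>, the choice
      \<open>t = - N g / K\<close> lets the linear term outweigh the quadratic one, contradicting
      \<open>quad\<close>.\<close>
    define K where "K = \<bar>C\<bar> + 1"
    have K: "K > 0" "C < K" by (auto simp: K_def)
    have "0 \<le> 2 * (- N g / K) * N g + (- N g / K)\<^sup>2 * C" by (rule quad)
    also have "\<dots> = (N g / K)\<^sup>2 * (C - 2 * K)"
      using K by (simp add: field_simps power2_eq_square)
    also have "\<dots> < 0" using K \<open>N g \<noteq> 0\<close> by (intro mult_pos_neg) auto
    finally show False by simp
  qed
  then have "g i = 0" if "i < n" for i using that by (simp add: N_def sum_nonneg_eq_0_iff)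
  then have eig: "(\<Sum>j<n. a i j * x j) = m * x i" if "i < n" for i using that by (simp add: g_def)
  have nz: "\<exists>i<n. x i \<noteq> 0"
    using x1 by (rule contrapos_pp) (simp add: N_def)
  show thesis
    by (rule that[OF nz eig bound[unfolded Q_def N_def]])
qed

section \<open>Degrees in the complement and edge counting\<close>

definition codegree :: "'a pair_pre_digraph \<Rightarrow> 'a \<Rightarrow> nat" where
  "codegree G v = card {u \<in> pverts G. u \<noteq> v \<and> (v, u) \<notin> parcs G}"

lemma arcs_over_edge:
  assumes "(u, v) \<in> R" "(v, u) \<in> R"
  shows "{e \<in> R. (\<lambda>(x, y). {x, y}) e = {u, v}} = {(u, v), (v, u)}"
proof (rule Set.set_eqI)
  fix e :: "'a \<times> 'a"
  obtain x y where e: "e = (x, y)" by (cases e)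
  have "{x, y} = {u, v} \<longleftrightarrow> x = u \<and> y = v \<or> x = v \<and> y = u" by (rule doubleton_eq_iff)
  with assms show "e \<in> {e \<in> R. (\<lambda>(x, y). {x, y}) e = {u, v}} \<longleftrightarrow> e \<in> {(u, v), (v, u)}"
    unfolding e mem_Collect_eq prod.case insert_iff empty_iff prod.inject by metis
qed

context pair_graph
begin

lemma parcs_commute: "(u, v) \<in> parcs G \<longleftrightarrow> (v, u) \<in> parcs G"
  using pair_sym_arcs by (auto simp: symmetric_def sym_def)

lemma not_loop: "(v, v) \<notin> parcs G"
  using pair_no_loops[of "(v, v)"] by auto

text \<open>Exactly two arcs lie over each edge; they are distinct because there are no
  loops.\<close>

lemma card_parcs: "card (parcs G) = 2 * card (edge_set G)"
proof -
  define f where "f = (\<lambda>(u :: 'a, v). {u, v})"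
  have img: "f ` parcs G = edge_set G"
    by (auto simp: f_def edge_set_def)
  have "card {e \<in> parcs G. f e = E} = 2" if "E \<in> edge_set G" for E
  proof -
    from that obtain u v where E: "E = {u, v}" and uv: "(u, v) \<in> parcs G"
      by (auto simp: edge_set_def)
    from uv have "(v, u) \<in> parcs G" using parcs_commute by blast
    with uv have "{e \<in> parcs G. f e = E} = {(u, v), (v, u)}"
      unfolding E f_def by (intro arcs_over_edge)
    moreover have "u \<noteq> v" using uv not_loop by auto
    ultimately show ?thesis by simp
  qed
  then show ?thesis
    using sum.image_gen[OF pair_finite_arcs, of "\<lambda>_. 1 :: nat" f] by (simp add: img)
qed

lemma sum_out_degree: "(\<Sum>v\<in>pverts G. out_degree (with_proj G) v) = card (parcs G)"
  using sum.group[OF pair_finite_arcs pair_finite_verts, of fst "\<lambda>_. 1 :: nat"]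
    arc_fst_in_verts
  by (simp add: Digraph.out_degree_def Digraph.out_arcs_def image_subset_iff)

lemma out_degree_eq_card: "out_degree (with_proj G) v = card {u \<in> pverts G. (v, u) \<in> parcs G}"
proof -
  have "out_arcs (with_proj G) v = Pair v ` {u \<in> pverts G. (v, u) \<in> parcs G}"
    by (auto simp: Digraph.out_arcs_def dest: in_arcsD2)
  then show ?thesis by (simp add: Digraph.out_degree_def card_image inj_on_def)
qed

lemma codegree_add_out_degree:
  assumes "v \<in> pverts G"
  shows "codegree G v + out_degree (with_proj G) v + 1 = card (pverts G)"
proof -
  let ?N = "{u \<in> pverts G. (v, u) \<in> parcs G}" and ?C = "{u \<in> pverts G. u \<noteq> v \<and> (v, u) \<notin> parcs G}"
  have "pverts G = insert v (?C \<union> ?N)" using assms not_loop by auto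
  then have "card (pverts G) = card (insert v (?C \<union> ?N))" by simp
  also have "\<dots> = card (?C \<union> ?N) + 1"
    using pair_finite_verts not_loop[of v] by (subst card_insert_disjoint) auto
  also have "card (?C \<union> ?N) = card ?C + card ?N"
    using pair_finite_verts by (intro card_Un_disjoint) auto
  finally show ?thesis by (simp add: codegree_def out_degree_eq_card)
qed

text \<open>Handshake count for the complement, in additive form to avoid truncated subtraction. It
  turns a prescribed number of edges into a prescribed total codegree.\<close>

lemma sum_codegree:
  "(\<Sum>v\<in>pverts G. codegree G v) + 2 * card (edge_set G) + card (pverts G)
    = card (pverts G) * card (pverts G)"
proof -
  have "(\<Sum>v\<in>pverts G. codegree G v + out_degree (with_proj G) v + 1)
      = card (pverts G) * card (pverts G)"
    by (simp add: codegree_add_out_degree cong: sum.cong del: One_nat_def)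
  then show ?thesis
    by (simp add: sum.distrib sum_out_degree card_parcs del: One_nat_def)
qed

end

section \<open>Adjacency form and spectral radius\<close>

locale labelled_graph = pair_graph G for G :: "nat pair_pre_digraph" +
  fixes n :: nat
  assumes verts_eq: "pverts G = {0..<n}" and n_pos: "n > 0"
begin

definition adj :: "nat \<Rightarrow> nat \<Rightarrow> real" where
  "adj i j = (if (i, j) \<in> parcs G then 1 else 0)"

definition coadj :: "nat \<Rightarrow> nat \<Rightarrow> real" where
  "coadj i j = (if i \<noteq> j \<and> (i, j) \<notin> parcs G then 1 else 0)"

lemma adj_eq: "adj i j = 1 - (if i = j then 1 else 0) - coadj i j"
  using not_loop by (auto simp: adj_def coadj_def)

lemma coadj_commute: "coadj i j = coadj j i"
  using parcs_commute by (auto simp: coadj_def)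

lemma sum_coadj: "(\<Sum>j<n. coadj i j) = codegree G i"
proof -
  have "(\<Sum>j<n. coadj i j) = (\<Sum>j\<in>{j\<in>{..<n}. i \<noteq> j \<and> (i, j) \<notin> parcs G}. 1)"
    unfolding coadj_def by (intro sum.inter_filter[symmetric]) simp
  also have "\<dots> = codegree G i"
    by (auto simp: codegree_def verts_eq intro!: arg_cong[of _ _ card])
  finally show ?thesis .
qed

text \<open>Bridge from matrices and vectors to functions on \<open>nat\<close>, of which only the
  values below \<open>n\<close> matter.\<close>

lemma eigenvalue_adjacency_mat_iff:
  "eigenvalue (adjacency_mat G) k \<longleftrightarrow>
    (\<exists>x. (\<exists>i<n. x i \<noteq> 0) \<and> (\<forall>i<n. (\<Sum>j<n. adj i j * x j) = k * x i))"
proof -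
  have mat: "adjacency_mat G = mat n n (\<lambda>(i, j). adj i j)"
    by (simp add: adjacency_mat_def adj_def verts_eq)
  show ?thesis
  proof
    assume "eigenvalue (adjacency_mat G) k"
    then obtain v where v: "v \<in> carrier_vec n" "v \<noteq> 0\<^sub>v n"
      and eig: "adjacency_mat G *\<^sub>v v = k \<cdot>\<^sub>v v"
      by (auto simp: eigenvalue_def eigenvector_def mat)
    have "\<exists>i<n. vec_index v i \<noteq> 0" using v by (fastforce simp: vec_eq_iff)
    moreover have "(\<Sum>j<n. adj i j * vec_index v j) = k * vec_index v i" if "i < n" for i
      using arg_cong[OF eig, of "\<lambda>w. vec_index w i"] that v
      by (simp add: mat scalar_prod_def atLeast0LessThan)
    ultimately show "\<exists>x. (\<exists>i<n. x i \<noteq> 0) \<and> (\<forall>i<n. (\<Sum>j<n. adj i j * x j) = k * x i)"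
      by blast
  next
    assume "\<exists>x. (\<exists>i<n. x i \<noteq> 0) \<and> (\<forall>i<n. (\<Sum>j<n. adj i j * x j) = k * x i)"
    then obtain x where "\<exists>i<n. x i \<noteq> 0" "\<forall>i<n. (\<Sum>j<n. adj i j * x j) = k * x i" by blast
    then have "eigenvector (adjacency_mat G) (vec n x) k"
      by (auto simp: eigenvector_def mat vec_eq_iff scalar_prod_def atLeast0LessThan)
    then show "eigenvalue (adjacency_mat G) k" by (auto simp: eigenvalue_def)
  qed
qed

lemma eigenvalue_le_rho: "eigenvalue (adjacency_mat G) k \<Longrightarrow> k \<le> rho G"
  unfolding rho_def by (intro Max_ge finite_adjacency_eigenvalues) simp

text \<open>The Rayleigh maximum is itself an eigenvalue of the adjacency matrix, hence at most
  \<open>rho G\<close>.\<close>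

lemma adjacency_form_le_rho: "(\<Sum>i<n. \<Sum>j<n. adj i j * y i * y j) \<le> rho G * (\<Sum>i<n. (y i)\<^sup>2)"
proof -
  have "adj i j = adj j i" for i j by (simp add: adj_def parcs_commute)
  then show ?thesis
  proof (rule symmetric_form_rayleigh[OF n_pos, of adj])
    fix m x assume x: "\<exists>i<n. x i \<noteq> 0" "\<And>i. i < n \<Longrightarrow> (\<Sum>j<n. adj i j * x j) = m * x i"
      and le: "\<And>y. (\<Sum>i<n. \<Sum>j<n. adj i j * y i * y j) \<le> m * (\<Sum>i<n. (y i)\<^sup>2)"
    have "eigenvalue (adjacency_mat G) m"
      unfolding eigenvalue_adjacency_mat_iff by (intro exI[of _ x] conjI x allI impI)
    then have "m \<le> rho G" by (rule eigenvalue_le_rho)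
    then have "m * (\<Sum>i<n. (y i)\<^sup>2) \<le> rho G * (\<Sum>i<n. (y i)\<^sup>2)"
      by (intro mult_right_mono sum_nonneg) auto
    with le show ?thesis by (rule order_trans)
  qed
qed

text \<open>Perron-type comparison of an arbitrary eigenvector \<open>y\<close> with the positive
  \<open>x\<close>: at an index \<open>r\<close> maximizing \<open>\<bar>y i\<bar> / x i\<close>,
  nonnegativity of \<open>adj\<close> gives
  \<open>l * \<bar>y r\<bar> \<le> k * \<bar>y r\<bar>\<close>.\<close>

lemma rho_eqI_positive_eigenvector:
  assumes pos: "\<And>i. i < n \<Longrightarrow> x i > 0"
    and eig: "\<And>i. i < n \<Longrightarrow> (\<Sum>j<n. adj i j * x j) = k * x i"
  shows "rho G = k"
  unfolding rho_def
proof (intro Max_eqI finite_adjacency_eigenvalues)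
  have "x 0 \<noteq> 0" using pos[OF n_pos] by simp
  with n_pos eig have "eigenvalue (adjacency_mat G) k"
    unfolding eigenvalue_adjacency_mat_iff by (intro exI[of _ x] conjI exI[of _ 0]) simp_all
  then show "k \<in> {k. eigenvalue (adjacency_mat G) k}" by simp
next
  fix l assume "l \<in> {k. eigenvalue (adjacency_mat G) k}"
  then obtain y where nz: "\<exists>i<n. y i \<noteq> 0" and y: "\<And>i. i < n \<Longrightarrow> (\<Sum>j<n. adj i j * y j) = l * y i"
    unfolding mem_Collect_eq eigenvalue_adjacency_mat_iff by metis
  \<comment> \<open>\<open>c\<close> is the least factor with
    \<open>\<bar>y i\<bar> \<le> c * x i\<close> for all \<open>i < n\<close>; the index where
    equality holds selects the row to compare.\<close>
  define c where "c = Max ((\<lambda>i. \<bar>y i\<bar> / x i) ` {..<n})"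
  have c: "\<bar>y i\<bar> \<le> c * x i" if "i < n" for i
  proof -
    have "\<bar>y i\<bar> / x i \<le> c" unfolding c_def using that by (intro Max_ge) auto
    with pos[OF that] show ?thesis by (simp add: divide_le_eq)
  qed
  have "c \<in> (\<lambda>i. \<bar>y i\<bar> / x i) ` {..<n}" unfolding c_def using n_pos by (intro Max_in) auto
  then obtain r where r: "r < n" "c = \<bar>y r\<bar> / x r" by auto
  then have yr: "\<bar>y r\<bar> = c * x r" using pos[of r] by simp
  have "c > 0"
  proof -
    from nz obtain i where i: "i < n" "y i \<noteq> 0" by blast
    then have "0 < c * x i" using c[of i] by linarith
    with pos[of i] i show ?thesis by (simp add: zero_less_mult_iff)
  qed
  have "l * \<bar>y r\<bar> \<le> \<bar>\<Sum>j<n. adj r j * y j\<bar>" using y r by (simp add: abs_mult mult_right_mono)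
  also have "\<dots> \<le> (\<Sum>j<n. \<bar>adj r j * y j\<bar>)" by (rule sum_abs)
  also have "\<dots> \<le> (\<Sum>j<n. c * (adj r j * x j))"
    using c by (intro sum_mono) (auto simp: adj_def)
  also have "\<dots> = k * \<bar>y r\<bar>" 
    unfolding sum_distrib_left[symmetric] eig[OF r(1)] yr by (simp only: mult_ac)
  finally show "l \<le> k" using yr \<open>c > 0\<close> pos[OF r(1)] by simp
qed

text \<open>Adjacency is all-ones minus identity minus \<open>coadj\<close>, and the form of
  \<open>coadj\<close> is rewritten by the Laplacian identity of the complement. The division by
  \<open>2\<close> corrects for ordered pairs.\<close>

lemma adjacency_form_eq:
  "(\<Sum>i<n. \<Sum>j<n. adj i j * x i * x j) = (\<Sum>i<n. x i)\<^sup>2 - (\<Sum>i<n. (1 + real (codegree G i)) * (x i)\<^sup>2)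
    + (\<Sum>i<n. \<Sum>j<n. coadj i j * (x i - x j)\<^sup>2) / 2"
proof -
  define c where "c = (\<Sum>i<n. \<Sum>j<n. coadj i j * x i * x j)"
  define d where "d = (\<Sum>i<n. codegree G i * (x i)\<^sup>2)"
  have d1: "(\<Sum>i<n. \<Sum>j<n. coadj i j * (x i)\<^sup>2) = d"
    by (simp add: d_def flip: sum_coadj sum_distrib_right)
  then have d2: "(\<Sum>i<n. \<Sum>j<n. coadj i j * (x j)\<^sup>2) = d"
    by (subst sum.swap) (simp add: coadj_commute)
  have "(\<Sum>i<n. \<Sum>j<n. coadj i j * (x i - x j)\<^sup>2) =
      (\<Sum>i<n. \<Sum>j<n. coadj i j * (x i)\<^sup>2 + coadj i j * (x j)\<^sup>2 - 2 * (coadj i j * x i * x j))"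
    by (intro sum.cong refl) (simp add: power2_eq_square algebra_simps)
  also have "\<dots> = 2 * d - 2 * c"
    unfolding sum_subtractf sum.distrib d1 d2 by (simp add: c_def flip: sum_distrib_left)
  finally have *: "(\<Sum>i<n. \<Sum>j<n. coadj i j * (x i - x j)\<^sup>2) = 2 * d - 2 * c" .
  have "(\<Sum>i<n. \<Sum>j<n. adj i j * x i * x j) =
      (\<Sum>i<n. \<Sum>j<n. x i * x j - (if i = j then x i * x j else 0) - coadj i j * x i * x j)"
    by (intro sum.cong refl) (simp add: adj_eq algebra_simps)
  also have "\<dots> = (\<Sum>i<n. x i)\<^sup>2 - (\<Sum>i<n. (x i)\<^sup>2) - c"
    by (simp add: sum_subtractf c_def power2_eq_square sum_product)
  finally show ?thesis
    by (simp add: * distrib_right sum.distrib diff_divide_distrib flip: d_def)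
qed

end

section \<open>The lower bound on the spectral radius and its equality case\<close>

context labelled_graph
begin

text \<open>Equivalently, the complement is the disjoint union of a 1-regular and a 2-regular graph,
  either of them possibly empty.\<close>

definition balanced :: bool where
  "balanced \<longleftrightarrow> (\<forall>i<n. codegree G i \<in> {1, 2}) \<and>
    (\<forall>i<n. \<forall>j<n. i \<noteq> j \<longrightarrow> (i, j) \<notin> parcs G \<longrightarrow> codegree G i = codegree G j)"

end

text \<open>\<open>k\<close> stands for the number of vertices of codegree \<open>2\<close> in the
  extremal case. \<open>l_root\<close> is \<open>(n - k) / (l + 2) + k / (l + 3) = 1\<close> cleared
  of denominators, and \<open>l_gt\<close> keeps the weights positive.\<close>

locale codegree_weights = labelled_graph +
  fixes k l :: real
  assumes sum_codegree_eq: "(\<Sum>i<n. real (codegree G i)) = n + k"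
    and l_gt: "l > -1"
    and l_root: "(l + 2) * (l + 3) = n * (l + 3) - k"
begin

definition weight :: "nat \<Rightarrow> real" where
  "weight i = 1 / (l + 1 + codegree G i)"

lemma weight_pos: "weight i > 0"
  using l_gt by (simp add: weight_def)

lemma weight_mult: "(l + 1 + codegree G i) * weight i = 1"
proof -
  have "l + 1 + codegree G i > 0" using l_gt by simp
  then show ?thesis by (simp add: weight_def)
qed

text \<open>The gap between \<open>weight i\<close> and the affine function of the codegree that
  agrees with the weights at codegrees \<open>1\<close> and \<open>2\<close>.\<close>

definition excess :: "nat \<Rightarrow> real" where
  "excess i =
    (real (codegree G i) - 1) * (real (codegree G i) - 2) * weight i / ((l + 2) * (l + 3))"

text \<open>\<open>(t - 1) * (t - 2)\<close> is negative only strictly between \<open>1\<close> and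
  \<open>2\<close>, where no integer lies.\<close>

lemma excess_nonneg: "excess i \<ge> 0"
proof -
  have "(real (codegree G i) - 1) * (real (codegree G i) - 2) \<ge> 0"
  proof (cases "codegree G i \<ge> 2")
    case False
    then have "codegree G i = 0 \<or> codegree G i = 1" by linarith
    then show ?thesis by auto
  qed simp
  then show ?thesis using weight_pos[of i] l_gt by (simp add: excess_def)
qed

lemma excess_eq_0_iff: "excess i = 0 \<longleftrightarrow> codegree G i \<in> {1, 2}"
proof -
  have "excess i = 0 \<longleftrightarrow> real (codegree G i) = real 1 \<or> real (codegree G i) = real 2"
    using weight_pos[of i] l_gt by (simp add: excess_def)
  then show ?thesis unfolding of_nat_eq_iff by simp
qed

text \<open>
  The chord of \<open>t \<mapsto> 1 / (l + 1 + t)\<close> through \<open>t = 1\<close> and \<open>t = 2\<close> lies below the function at all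
  integers, and \<open>l\<close> is chosen so that the values of the chord at the codegrees sum to \<open>1\<close>.
\<close>

lemma sum_weight: "(\<Sum>i<n. weight i) = 1 + (\<Sum>i<n. excess i)"
proof -
  define P where "P = (l + 2) * (l + 3)"
  have P: "P > 0" using l_gt by (simp add: P_def)
  have "P * weight i = (l + 4 - codegree G i) + P * excess i" for i
  proof -
    define d w where "d = real (codegree G i)" and "w = weight i"
    have w: "(l + 1 + d) * w = 1" using weight_mult by (simp add: d_def w_def)
    have "P * excess i = (d - 1) * (d - 2) * w"
      using P by (simp add: excess_def d_def w_def flip: P_def)
    \<comment> \<open>Rests on the identity
      \<open>P = (l + 4 - d) * (l + 1 + d) + (d - 1) * (d - 2)\<close>; the first product then
      collapses because \<open>(l + 1 + d) * w = 1\<close>.\<close>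
    moreover have "P * w = (l + 4 - d) * ((l + 1 + d) * w) + (d - 1) * (d - 2) * w"
      by (simp add: P_def algebra_simps)
    ultimately show ?thesis unfolding w by (simp add: d_def w_def)
  qed
  then have "P * (\<Sum>i<n. weight i) = (\<Sum>i<n. (l + 4 - codegree G i) + P * excess i)"
    by (simp only: sum_distrib_left)
  also have "\<dots> = n * (l + 4) - (n + k) + P * (\<Sum>i<n. excess i)"
    by (simp add: sum.distrib sum_subtractf sum_codegree_eq flip: sum_distrib_left)
  also have "n * (l + 4) - (n + k) = P"
    using l_root by (simp add: P_def algebra_simps)
  also have "P + P * (\<Sum>i<n. excess i) = P * (1 + (\<Sum>i<n. excess i))"
    by (simp add: distrib_left)
  finally show ?thesis using P by simp
qed

text \<open>With \<open>T\<close> the sum of the weights, \<open>weight_mult\<close> turns the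
  diagonal term of \<open>adjacency_form_eq\<close> into \<open>T\<close> minus \<open>l\<close>
  times the squared norm. What remains is \<open>T * (T - 1)\<close>, and \<open>T - 1\<close> is
  the total excess.\<close>

lemma adjacency_form_weight:
  "(\<Sum>i<n. \<Sum>j<n. adj i j * weight i * weight j) = l * (\<Sum>i<n. (weight i)\<^sup>2)
    + (\<Sum>i<n. weight i) * (\<Sum>i<n. excess i)
    + (\<Sum>i<n. \<Sum>j<n. coadj i j * (weight i - weight j)\<^sup>2) / 2"
proof -
  have "(1 + real (codegree G i)) * (weight i)\<^sup>2 = weight i - l * (weight i)\<^sup>2" for i
  proof -
    have "(l + 1 + codegree G i) * weight i * weight i = weight i"
      by (simp only: weight_mult mult_1_left)
    then show ?thesis by (simp add: power2_eq_square algebra_simps)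
  qed
  then have "(\<Sum>i<n. (1 + real (codegree G i)) * (weight i)\<^sup>2) =
      (\<Sum>i<n. weight i) - l * (\<Sum>i<n. (weight i)\<^sup>2)"
    by (simp only: sum_subtractf sum_distrib_left)
  then show ?thesis
    unfolding adjacency_form_eq by (simp add: sum_weight power2_eq_square algebra_simps)
qed

lemma sum_weight_sq_pos: "(\<Sum>i<n. (weight i)\<^sup>2) > 0"
  using n_pos weight_pos by (intro sum_pos zero_less_power) auto

lemma sum_weight_ge_1: "(\<Sum>i<n. weight i) \<ge> 1"
  by (simp add: sum_weight sum_nonneg excess_nonneg)

lemma coadj_form_nonneg: "(\<Sum>i<n. \<Sum>j<n. coadj i j * (weight i - weight j)\<^sup>2) \<ge> 0"
  by (intro sum_nonneg) (simp add: coadj_def)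

text \<open>Both summands on the left are nonnegative, so this single inequality yields the lower
  bound and also controls equality.\<close>

lemma rho_gap:
  "(\<Sum>i<n. weight i) * (\<Sum>i<n. excess i) + (\<Sum>i<n. \<Sum>j<n. coadj i j * (weight i - weight j)\<^sup>2) / 2
    \<le> (rho G - l) * (\<Sum>i<n. (weight i)\<^sup>2)"
  using adjacency_form_le_rho[of weight]
  unfolding adjacency_form_weight left_diff_distrib by linarith

lemma rho_ge: "l \<le> rho G"
proof -
  have "0 \<le> (\<Sum>i<n. weight i) * (\<Sum>i<n. excess i)"
    using sum_weight_ge_1 by (simp add: sum_nonneg excess_nonneg)
  then have "0 \<le> (rho G - l) * (\<Sum>i<n. (weight i)\<^sup>2)"
    using coadj_form_nonneg rho_gap by linarith
  with sum_weight_sq_pos show ?thesis by (simp add: zero_le_mult_iff)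
qed

lemma rho_eq_iff: "rho G = l \<longleftrightarrow> balanced"
proof
  assume eq: "rho G = l"
  define S E where "S = (\<Sum>i<n. excess i)"
    and "E = (\<Sum>i<n. \<Sum>j<n. coadj i j * (weight i - weight j)\<^sup>2)"
  have "0 \<le> S" by (simp add: S_def sum_nonneg excess_nonneg)
  then have "S \<le> (\<Sum>i<n. weight i) * S" using sum_weight_ge_1 mult_right_mono by fastforce
  moreover have "(\<Sum>i<n. weight i) * S + E / 2 \<le> 0" using rho_gap by (simp add: eq S_def E_def)
  moreover have "0 \<le> E" using coadj_form_nonneg by (simp add: E_def)
  ultimately have "S = 0" "E = 0" using \<open>0 \<le> S\<close> by linarith+
  have deg: "codegree G i \<in> {1, 2}" if "i < n" for i
  proof -
    have "excess i = 0"
      using \<open>S = 0\<close> that by (simp add: S_def sum_nonneg_eq_0_iff excess_nonneg)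
    then show ?thesis by (simp only: excess_eq_0_iff)
  qed
  have "codegree G i = codegree G j" if ij: "i < n" "j < n" "i \<noteq> j" "(i, j) \<notin> parcs G" for i j
  proof -
    have nn: "coadj i j * (weight i - weight j)\<^sup>2 \<ge> 0" for i j by (simp add: coadj_def)
    have "(\<Sum>j<n. coadj i j * (weight i - weight j)\<^sup>2) = 0"
      using \<open>E = 0\<close> ij(1) nn by (simp add: E_def sum_nonneg_eq_0_iff sum_nonneg)
    then have "coadj i j * (weight i - weight j)\<^sup>2 = 0"
      using ij(2) nn by (simp add: sum_nonneg_eq_0_iff)
    then have "weight i = weight j" using ij by (simp add: coadj_def)
    then show ?thesis using l_gt by (simp add: weight_def frac_eq_eq)
  qed
  with deg show balanced by (simp add: balanced_def)
next
  assume bal: balanced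
  then have "excess i = 0" if "i < n" for i
    using that unfolding excess_eq_0_iff balanced_def by blast
  then have T: "(\<Sum>j<n. weight j) = 1" by (simp add: sum_weight)
  show "rho G = l"
  proof (rule rho_eqI_positive_eigenvector[of weight])
    fix i assume i: "i < n"
    \<comment> \<open>Where \<open>coadj\<close> is nonzero, balance equates the codegrees and hence
      the weights.\<close>
    have "coadj i j * weight j = coadj i j * weight i" if "j < n" for j
      using bal i that by (auto simp: balanced_def coadj_def weight_def)
    then have "(\<Sum>j<n. coadj i j * weight j) = (\<Sum>j<n. coadj i j * weight i)"
      by (intro sum.cong) auto
    also have "\<dots> = codegree G i * weight i"
      by (simp only: sum_coadj sum_distrib_right[symmetric])
    finally have "(\<Sum>j<n. coadj i j * weight j) = codegree G i * weight i" .
    moreover have "(\<Sum>j<n. adj i j * weight j) =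
        (\<Sum>j<n. weight j - (if i = j then weight j else 0) - coadj i j * weight j)"
      by (intro sum.cong refl) (simp add: adj_eq algebra_simps)
    ultimately have "(\<Sum>j<n. adj i j * weight j) = 1 - weight i - codegree G i * weight i"
      using i by (simp add: sum_subtractf T)
    also have "\<dots> = l * weight i"
      using weight_mult[of i] by (simp add: distrib_right)
    finally show "(\<Sum>j<n. adj i j * weight j) = l * weight i" .
  qed (rule weight_pos)
qed

end

section \<open>Joins seen through the complement\<close>

lemma pair_graphI:
  assumes "finite (pverts G)" "parcs G \<subseteq> pverts G \<times> pverts G"
    and "\<And>u v. (u, v) \<in> parcs G \<Longrightarrow> (v, u) \<in> parcs G" "\<And>v. (v, v) \<notin> parcs G"
  shows "pair_graph G"
proof
  fix e assume e: "e \<in> parcs G"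
  then show "fst e \<in> pverts G" "snd e \<in> pverts G" using assms(2) by auto
  show "fst e \<noteq> snd e" using e assms(4) by (metis prod.collapse)
next
  show "finite (parcs G)" using assms(1,2) by (meson finite_SigmaI finite_subset)
  show "symmetric (with_proj G)" using assms(3) by (auto simp: symmetric_def intro: symI)
qed (rule assms)

definition induced :: "'a pair_pre_digraph \<Rightarrow> 'a set \<Rightarrow> 'a pair_pre_digraph" where
  "induced G V = \<lparr>pverts = V, parcs = parcs G \<inter> V \<times> V\<rparr>"

text \<open>For \<open>V\<close> inside the vertex set: \<open>V\<close> is a union of connected
  components of the complement.\<close>

definition co_closed :: "'a pair_pre_digraph \<Rightarrow> 'a set \<Rightarrow> bool" where
  "co_closed G V \<longleftrightarrow> (\<forall>v\<in>V. \<forall>u\<in>pverts G. u \<noteq> v \<longrightarrow> (v, u) \<notin> parcs G \<longrightarrow> u \<in> V)"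

text \<open>\<open>r\<close> counts a vertex together with its nonneighbours, so
  \<open>r = 2\<close> and \<open>r = 3\<close> mean codegrees \<open>1\<close> and
  \<open>2\<close>; \<open>r \<le> m\<close> keeps \<open>m - r\<close> exact.\<close>

lemma coregular_graph_iff_codegree:
  "coregular_graph m r H \<longleftrightarrow>
    pair_graph H \<and> card (pverts H) = m \<and> r \<le> m \<and> (\<forall>v\<in>pverts H. codegree H v + 1 = r)"
proof -
  have "out_degree (with_proj H) v = m - r \<longleftrightarrow> codegree H v + 1 = r"
    if "pair_graph H" "card (pverts H) = m" "r \<le> m" "v \<in> pverts H" for v
    using pair_graph.codegree_add_out_degree[OF that(1,4)] that(2,3) by linarith
  then show ?thesis unfolding coregular_graph_def by blast
qed

context pair_graph
begin

lemma pair_graph_induced: "V \<subseteq> pverts G \<Longrightarrow> pair_graph (induced G V)"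
  using finite_subset[OF _ pair_finite_verts] parcs_commute not_loop
  by (intro pair_graphI) (simp_all add: induced_def)

lemma codegree_induced:
  assumes "co_closed G V" "V \<subseteq> pverts G" "v \<in> V"
  shows "codegree (induced G V) v = codegree G v"
proof -
  have "{u \<in> V. u \<noteq> v \<and> (v, u) \<notin> parcs G \<inter> V \<times> V} = {u \<in> pverts G. u \<noteq> v \<and> (v, u) \<notin> parcs G}"
    using assms by (auto simp: co_closed_def)
  then show ?thesis by (simp add: codegree_def induced_def)
qed

lemma coregular_graph_induced:
  assumes "co_closed G V" "V \<subseteq> pverts G" "r \<le> card V" "\<And>v. v \<in> V \<Longrightarrow> codegree G v + 1 = r"
  shows "coregular_graph (card V) r (induced G V)"
proof -
  have "pverts (induced G V) = V" by (simp add: induced_def)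
  then show ?thesis
    using assms pair_graph_induced by (simp add: coregular_graph_iff_codegree codegree_induced)
qed

text \<open>A missing arc between \<open>V\<close> and \<open>W\<close> would, by closedness, put a
  vertex into both sets.\<close>

lemma eq_graph_join_induced:
  assumes "co_closed G V" "co_closed G W" "V \<union> W = pverts G" "V \<inter> W = {}"
  shows "G = graph_join (induced G V) (induced G W)"
proof -
  have "parcs G = parcs G \<inter> V \<times> V \<union> parcs G \<inter> W \<times> W \<union> V \<times> W \<union> W \<times> V" (is "_ = ?R")
  proof (intro equalityI subrelI)
    fix u v assume "(u, v) \<in> parcs G"
    with in_arcsD1 in_arcsD2 assms(3) show "(u, v) \<in> ?R" by blast
  next
    fix u v assume "(u, v) \<in> ?R"
    then consider "(u, v) \<in> parcs G" | "u \<in> V" "v \<in> W" | "u \<in> W" "v \<in> V" by blast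
    then show "(u, v) \<in> parcs G"
    proof cases
      case 2
      with assms have "v \<in> pverts G" "v \<noteq> u" "v \<notin> V" by auto
      with 2 assms(1) show ?thesis unfolding co_closed_def by metis
    next
      case 3
      with assms have "v \<in> pverts G" "v \<noteq> u" "v \<notin> W" by auto
      with 3 assms(2) show ?thesis unfolding co_closed_def by metis
    qed
  qed
  with assms(3) show ?thesis by (simp add: graph_join_def induced_def)
qed

text \<open>Vertices of \<open>W\<close> are adjacent to \<open>a\<close>, and vertices of
  \<open>V\<close> reach \<open>a\<close> through \<open>b\<close>.\<close>

lemma connected_if_complete_bipartition:
  assumes "V \<union> W = pverts G" "a \<in> V" "b \<in> W" "V \<times> W \<subseteq> parcs G"
  shows "Digraph_Component.connected (with_proj G)"
proof -
  have VW: "(u, v) \<in> parcs G" "(v, u) \<in> parcs G" if "u \<in> V" "v \<in> W" for u v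
    using assms(4) that parcs_commute by blast+
  have to_a: "u \<rightarrow>\<^sup>*\<^bsub>with_proj G\<^esub> a" and from_a: "a \<rightarrow>\<^sup>*\<^bsub>with_proj G\<^esub> u"
    if "u \<in> pverts G" for u
  proof -
    from that assms(1) consider "u \<in> W" | "u \<in> V" by blast
    then have "u \<rightarrow>\<^sup>*\<^bsub>with_proj G\<^esub> a \<and> a \<rightarrow>\<^sup>*\<^bsub>with_proj G\<^esub> u"
    proof cases
      case 1
      with VW[OF assms(2)] show ?thesis by (intro conjI reachable_adjI) simp_all
    next
      case 2
      have "u \<rightarrow>\<^sup>*\<^bsub>with_proj G\<^esub> b" "b \<rightarrow>\<^sup>*\<^bsub>with_proj G\<^esub> u"
        "b \<rightarrow>\<^sup>*\<^bsub>with_proj G\<^esub> a" "a \<rightarrow>\<^sup>*\<^bsub>with_proj G\<^esub> b"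
        using VW[OF 2 assms(3)] VW[OF assms(2,3)] by (intro reachable_adjI; simp)+
      then show ?thesis using reachable_trans by blast
    qed
    then show "u \<rightarrow>\<^sup>*\<^bsub>with_proj G\<^esub> a" "a \<rightarrow>\<^sup>*\<^bsub>with_proj G\<^esub> u" by blast+
  qed
  \<comment> \<open>Connectedness is strong connectivity of the symmetric closure, so reachability
    is transferred there.\<close>
  have "u \<rightarrow>\<^sup>*\<^bsub>with_proj (mk_symmetric (with_proj G))\<^esub> v" if "u \<in> pverts G" "v \<in> pverts G" for u v
    using reachable_trans[OF to_a[OF that(1)] from_a[OF that(2)]] by (rule reachable_mk_symmetricI)
  moreover have "pverts G \<noteq> {}" using assms by auto
  ultimately show ?thesis by (simp add: connected_def strongly_connected_def)
qed

end

lemma codegree_graph_join: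
  assumes "pverts H1 \<inter> pverts H2 = {}" "pair_graph H1" "pair_graph H2"
  shows "v \<in> pverts H1 \<Longrightarrow> codegree (graph_join H1 H2) v = codegree H1 v"
    and "v \<in> pverts H2 \<Longrightarrow> codegree (graph_join H1 H2) v = codegree H2 v"
proof -
  interpret H1: pair_graph H1 by fact
  interpret H2: pair_graph H2 by fact
  have sub: "parcs H1 \<subseteq> pverts H1 \<times> pverts H1" "parcs H2 \<subseteq> pverts H2 \<times> pverts H2"
    using H1.wellformed' H2.wellformed' by auto
  show "codegree (graph_join H1 H2) v = codegree H1 v" if "v \<in> pverts H1"
    unfolding codegree_def graph_join_def using sub assms(1) that
    by (intro arg_cong[of _ _ card]) auto
  show "codegree (graph_join H1 H2) v = codegree H2 v" if "v \<in> pverts H2"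
    unfolding codegree_def graph_join_def using sub assms(1) that
    by (intro arg_cong[of _ _ card]) auto
qed

context labelled_graph
begin

text \<open>The two parts are the classes of codegree \<open>1\<close> and \<open>2\<close>, which
  balance makes \<open>co_closed\<close>. The bounds on \<open>m\<close> supply the condition
  \<open>r \<le> m\<close> hidden in \<open>coregular_graph\<close>.\<close>

lemma balanced_imp_join:
  assumes bal: balanced and sum: "(\<Sum>i<n. codegree G i) = n + m" and m: "3 \<le> m" "m + 2 \<le> n"
  shows "\<exists>H1 H2. coregular_graph (n - m) 2 H1 \<and> coregular_graph m 3 H2 \<and>
    pverts H1 \<inter> pverts H2 = {} \<and> G = graph_join H1 H2"
proof -
  define V where "V d = {i. i < n \<and> codegree G i = d}" for d
  have fin: "finite (V d)" for d by (simp add: V_def)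
  have un: "V 1 \<union> V 2 = {..<n}" using bal by (auto simp: V_def balanced_def)
  have disj: "V 1 \<inter> V 2 = {}" by (rule equals0I) (auto simp: V_def)
  have "card (V 1) + card (V 2) = n"
    using card_Un_disjoint[OF fin fin disj] unfolding un by simp
  moreover have "(\<Sum>i<n. codegree G i) = card (V 1) + 2 * card (V 2)"
    unfolding un[symmetric] by (subst sum.union_disjoint[OF fin fin disj]) (simp add: V_def)
  \<comment> \<open>The class sizes add up to \<open>n\<close>, and to \<open>n + m\<close> when the
    second is counted twice.\<close>
  ultimately have card: "card (V 1) = n - m" "card (V 2) = m" using sum by linarith+
  have closed: "co_closed G (V d)" for d
    using bal unfolding co_closed_def V_def balanced_def verts_eq by auto
  have sub: "V d \<subseteq> pverts G" for d by (auto simp: V_def verts_eq)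
  have coreg: "coregular_graph (card (V d)) (d + 1) (induced G (V d))" if "d + 1 \<le> card (V d)" for d
    by (rule coregular_graph_induced[OF closed sub that]) (simp add: V_def)
  have "coregular_graph (n - m) 2 (induced G (V 1))" "coregular_graph m 3 (induced G (V 2))"
    using coreg[of 1] coreg[of 2] m unfolding card by (simp_all add: numeral_2_eq_2 numeral_3_eq_3)
  moreover have "G = graph_join (induced G (V 1)) (induced G (V 2))"
    using un by (intro eq_graph_join_induced closed disj) (simp add: verts_eq atLeast0LessThan)
  moreover have "pverts (induced G (V 1)) \<inter> pverts (induced G (V 2)) = {}"
    using disj by (simp add: induced_def)
  ultimately show ?thesis by blast
qed

lemma join_imp_balanced:
  assumes "coregular_graph m1 2 H1" "coregular_graph m2 3 H2"
    "pverts H1 \<inter> pverts H2 = {}" "G = graph_join H1 H2"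
  shows balanced
proof -
  have H: "pair_graph H1" "pair_graph H2" "\<And>v. v \<in> pverts H1 \<Longrightarrow> codegree H1 v = 1"
    "\<And>v. v \<in> pverts H2 \<Longrightarrow> codegree H2 v = 2"
    using assms(1,2) by (auto simp: coregular_graph_iff_codegree)
  have V: "i < n \<longleftrightarrow> i \<in> pverts H1 \<union> pverts H2" for i
    using verts_eq by (auto simp: assms(4) graph_join_def)
  have deg: "codegree G i = (if i \<in> pverts H1 then 1 else 2)" if "i < n" for i
    using that codegree_graph_join[OF assms(3) H(1,2), of i] H(3,4)[of i]
    by (auto simp: V assms(4))
  have "i \<in> pverts H1 \<longleftrightarrow> j \<in> pverts H1" if "i < n" "j < n" "(i, j) \<notin> parcs G" for i j
    using that unfolding V by (auto simp: assms(4) graph_join_def)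
  with deg show ?thesis by (simp add: balanced_def)
qed

end

section \<open>A graph attaining the bound\<close>

text \<open>The complement consists of a perfect matching on \<open>{..<s}\<close>, pairing
  \<open>2 * t\<close> with \<open>2 * t + 1\<close>, and a cycle through
  \<open>{s..<s + m}\<close>.\<close>

locale matching_plus_cycle =
  fixes s m :: nat
  assumes even_s: "even s" and m_ge: "m \<ge> 3"
begin

definition successor :: "nat \<Rightarrow> nat" where
  "successor i = (if i = s + m - 1 then s else i + 1)"

definition predecessor :: "nat \<Rightarrow> nat" where
  "predecessor i = (if i = s then s + m - 1 else i - 1)"

text \<open>On the matching part the relation is reflexive; \<open>graph\<close> therefore excludes
  \<open>i = j\<close> explicitly.\<close>

definition nonadjacent :: "nat \<Rightarrow> nat \<Rightarrow> bool" where
  "nonadjacent i j \<longleftrightarrow> i < s \<and> j < s \<and> i div 2 = j div 2 \<or>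
    s \<le> i \<and> s \<le> j \<and> (j = successor i \<or> i = successor j)"

definition graph :: "nat pair_pre_digraph" where
  "graph = \<lparr>pverts = {0..<s + m},
    parcs = {(i, j). i < s + m \<and> j < s + m \<and> i \<noteq> j \<and> \<not> nonadjacent i j}\<rparr>"

lemma nonadjacent_commute: "nonadjacent i j \<longleftrightarrow> nonadjacent j i"
proof -
  have "i div 2 = j div 2 \<longleftrightarrow> j div 2 = i div 2" by (rule eq_commute)
  then show ?thesis unfolding nonadjacent_def by (simp only: conj_ac disj_ac)
qed

lemma is_pair_graph: "pair_graph graph"
proof (rule pair_graphI)
  show "(v, u) \<in> parcs graph" if "(u, v) \<in> parcs graph" for u v
    using that nonadjacent_commute[of u v] by (simp add: graph_def)
qed (auto simp: graph_def)

lemma codegree_graph_eq: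
  "i < s + m \<Longrightarrow> codegree graph i = card {j. j < s + m \<and> j \<noteq> i \<and> nonadjacent i j}"
  unfolding codegree_def graph_def by (intro arg_cong[of _ _ card]) auto

lemma codegree_matching:
  assumes "i < s"
  shows "codegree graph i = 1"
proof -
  \<comment> \<open>The matching partner of \<open>i\<close>; evenness of \<open>s\<close> keeps it
    below \<open>s\<close>.\<close>
  define k where "k = (if even i then i + 1 else i - 1)"
  have k: "k < s" "k \<noteq> i" using assms even_s unfolding k_def by presburger+
  have "i div 2 = j div 2 \<longleftrightarrow> j = i \<or> j = k" for j
  proof (cases "even i")
    case True
    then obtain t where "i = 2 * t" "k = 2 * t + 1" by (auto simp: k_def)
    moreover have "t = j div 2 \<longleftrightarrow> j = 2 * t \<or> j = 2 * t + 1" by linarith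
    ultimately show ?thesis by simp
  next
    case False
    then obtain t where "i = 2 * t + 1" "k = 2 * t" by (auto simp: k_def elim!: oddE)
    moreover have "t = j div 2 \<longleftrightarrow> j = 2 * t + 1 \<or> j = 2 * t" by linarith
    ultimately show ?thesis by simp
  qed
  then have "j < s + m \<and> j \<noteq> i \<and> nonadjacent i j \<longleftrightarrow> j = k" for j
    using assms k by (auto simp: nonadjacent_def)
  then show ?thesis using assms by (simp add: codegree_graph_eq)
qed

lemma successor_range:
  assumes "s \<le> i" "i < s + m"
  shows "s \<le> successor i" "successor i < s + m" "successor i \<noteq> i"
  unfolding successor_def using assms m_ge by (cases "i = s + m - 1"; simp; arith)+

lemma predecessor_range:
  assumes "s \<le> i" "i < s + m"
  shows "s \<le> predecessor i" "predecessor i < s + m" "predecessor i \<noteq> i"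
  unfolding predecessor_def using assms m_ge by (cases "i = s"; simp; arith)+

text \<open>Here \<open>m \<ge> 3\<close> matters: on a cycle of length \<open>2\<close> the two
  neighbours would coincide.\<close>

lemma successor_neq_predecessor:
  assumes "s \<le> i" "i < s + m"
  shows "successor i \<noteq> predecessor i"
  unfolding successor_def predecessor_def using assms m_ge
  by (cases "i = s + m - 1"; cases "i = s") simp_all

lemma eq_successor_iff:
  assumes "s \<le> i" "i < s + m" "s \<le> j" "j < s + m"
  shows "i = successor j \<longleftrightarrow> j = predecessor i"
  unfolding successor_def predecessor_def using assms m_ge
  by (cases "j = s + m - 1"; cases "i = s") auto

lemma codegree_cycle:
  assumes i: "s \<le> i" "i < s + m"
  shows "codegree graph i = 2"
proof -
  have "j < s + m \<and> j \<noteq> i \<and> nonadjacent i j \<longleftrightarrow> j = successor i \<or> j = predecessor i" for j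
  proof
    assume "j < s + m \<and> j \<noteq> i \<and> nonadjacent i j"
    then have "s \<le> j" "j < s + m" "j = successor i \<or> i = successor j"
      using i by (simp_all add: nonadjacent_def)
    with eq_successor_iff[OF i] show "j = successor i \<or> j = predecessor i" by metis
  next
    assume j: "j = successor i \<or> j = predecessor i"
    then have range: "s \<le> j" "j < s + m" "j \<noteq> i"
      using successor_range[OF i] predecessor_range[OF i] by metis+
    from j have succ: "j = successor i \<or> i = successor j"
      unfolding eq_successor_iff[OF i range(1,2)] .
    have "nonadjacent i j"
      unfolding nonadjacent_def by (rule disjI2, intro conjI i range succ)
    then show "j < s + m \<and> j \<noteq> i \<and> nonadjacent i j" by (intro conjI range)
  qed
  then show ?thesis
    using i successor_neq_predecessor[OF i] by (simp add: codegree_graph_eq Collect_disj_eq)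
qed

lemma sum_codegree_graph: "(\<Sum>i<s + m. codegree graph i) = s + 2 * m"
proof -
  have "(\<Sum>i<s + m. codegree graph i) =
      (\<Sum>i=0..<s. codegree graph i) + (\<Sum>i=s..<s + m. codegree graph i)"
    unfolding lessThan_atLeast0 by (simp only: sum.atLeastLessThan_concat le0 le_add1)
  then show ?thesis by (simp add: codegree_matching codegree_cycle)
qed

lemma connected_graph:
  assumes "s > 0"
  shows "Digraph_Component.connected (with_proj graph)"
proof -
  interpret pair_graph graph by (rule is_pair_graph)
  show ?thesis
    by (rule connected_if_complete_bipartition[of "{..<s}" "{s..<s + m}" 0 s])
      (use assms m_ge in \<open>auto simp: graph_def nonadjacent_def\<close>)
qed

lemma balanced_graph: "labelled_graph.balanced graph (s + m)"
proof -
  interpret pair_graph graph by (rule is_pair_graph)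
  interpret labelled_graph graph "s + m"
    by unfold_locales (use m_ge in \<open>auto simp: graph_def\<close>)
  have "codegree graph i = (if i < s then 1 else 2)" if "i < s + m" for i
    using that codegree_matching codegree_cycle by simp
  moreover have "i < s \<longleftrightarrow> j < s" if "i < s + m" "j < s + m" "i \<noteq> j" "(i, j) \<notin> parcs graph" for i j
    using that by (auto simp: graph_def nonadjacent_def)
  ultimately show ?thesis unfolding balanced_def by simp
qed

end

section \<open>The value of the minimum and the minimizers\<close>

theorem theorem3p10:
  fixes n p e :: nat
  assumes "n \<ge> 6" and "even n"
    and "1 \<le> p" and "real p \<le> (real n - 4) / 2"
    and "real e = real (n choose 2) - ((real n + 2) / 2 + real p)"
  shows "rho_min n e = (real n - 5 + sqrt ((real n + 1)\<^sup>2 - 8 * real p - 8)) / 2 \<and>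
    minimizers n e =
      {G \<in> conn_graphs n e. \<exists>H1 H2.
        coregular_graph (n - 2 * p - 2) 2 H1 \<and> coregular_graph (2 * p + 2) 3 H2 \<and>
        pverts H1 \<inter> pverts H2 = {} \<and> G = graph_join H1 H2}"
proof -
  \<comment> \<open>\<open>m\<close> is both the order of the second part of the join and the amount
    by which the total codegree exceeds \<open>n\<close>.\<close>
  define m where "m = 2 * p + 2"
  define l where "l = (real n - 5 + sqrt ((real n + 1)\<^sup>2 - 8 * real p - 8)) / 2"
  have m: "3 \<le> m" "m + 2 \<le> n" "even m" "n - 2 * p - 2 = n - m"
    using assms(3,4) by (auto simp: m_def)
  have "real (n choose 2) = real n * (real n - 1) / 2"
    using assms(1,2) by (simp add: choose_two of_nat_diff real_of_nat_div)
  then have "real (2 * e + 2 * n + m) = real (n * n)"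
    using assms(5) by (simp add: m_def field_simps)
  \<comment> \<open>In this form over \<open>nat\<close>, the edge count combines with
    \<open>sum_codegree\<close> to give total codegree \<open>n + m\<close>.\<close>
  then have e: "2 * e + 2 * n + m = n * n" by (simp only: of_nat_eq_iff)
  \<comment> \<open>The upper bound on \<open>p\<close> makes the radicand nonnegative, so squaring
    recovers the quadratic \<open>l_root\<close>.\<close>
  have "(real n + 1)\<^sup>2 - 8 * real p - 8 \<ge> (real n - 1)\<^sup>2"
    using assms(4) by (simp add: power2_eq_square algebra_simps)
  then have "(real n + 1)\<^sup>2 - 8 * real p - 8 \<ge> 0" by (rule order_trans[rotated]) simp
  moreover have "2 * l - (real n - 5) = sqrt ((real n + 1)\<^sup>2 - 8 * real p - 8)"
    by (simp add: l_def field_simps)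
  ultimately have "(2 * l - (real n - 5))\<^sup>2 = (real n + 1)\<^sup>2 - 8 * real p - 8"
    and "2 * l - (real n - 5) \<ge> 0" by simp_all
  then have l: "(l + 2) * (l + 3) = n * (l + 3) - real m" "l > -1"
    using assms(1) by (simp_all add: m_def power2_eq_square algebra_simps)
  have weights: "codegree_weights G n (real m) l" "(\<Sum>i<n. codegree G i) = n + m"
    if "G \<in> conn_graphs n e" for G
  proof -
    from that interpret pair_graph G by (simp add: conn_graphs_def)
    have V: "pverts G = {0..<n}" using that by (simp add: conn_graphs_def)
    show sum: "(\<Sum>i<n. codegree G i) = n + m"
      using sum_codegree that e by (simp add: conn_graphs_def V atLeast0LessThan)
    show "codegree_weights G n (real m) l"
      using V l assms(1) arg_cong[OF sum, of real] by unfold_locales simp_all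
  qed
  have rho_ge: "l \<le> rho G" if "G \<in> conn_graphs n e" for G
    by (rule codegree_weights.rho_ge[OF weights(1)[OF that]])
  have rho_eq: "rho G = l \<longleftrightarrow> labelled_graph.balanced G n" if "G \<in> conn_graphs n e" for G
    by (rule codegree_weights.rho_eq_iff[OF weights(1)[OF that]])
  have bal: "labelled_graph.balanced G n \<longleftrightarrow> (\<exists>H1 H2.
        coregular_graph (n - m) 2 H1 \<and> coregular_graph m 3 H2 \<and>
        pverts H1 \<inter> pverts H2 = {} \<and> G = graph_join H1 H2)" if "G \<in> conn_graphs n e" for G
  proof -
    interpret codegree_weights G n "real m" l by (rule weights(1)[OF that])
    show ?thesis
      using balanced_imp_join[OF _ weights(2)[OF that] m(1,2)] join_imp_balanced by blast
  qed
  \<comment> \<open>The explicit graph with \<open>s = n - m\<close> is admissible: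
    \<open>n - m\<close> is even and at least \<open>2\<close>, which gives the matching and
    connectedness, and its total codegree forces exactly \<open>e\<close> edges.\<close>
  obtain G where G: "G \<in> conn_graphs n e" "labelled_graph.balanced G n"
  proof -
    interpret M: matching_plus_cycle "n - m" m
      by unfold_locales (use assms(2) m in auto)
    have n: "n - m + m = n" using m(2) by simp
    interpret pair_graph M.graph by (rule M.is_pair_graph)
    have V: "pverts M.graph = {0..<n}" by (simp add: M.graph_def n)
    have "(\<Sum>i<n. codegree M.graph i) = n + m" using M.sum_codegree_graph m(2) by (simp add: n)
    then have "card (edge_set M.graph) = e"
      using sum_codegree e by (simp add: V atLeast0LessThan)
    moreover have "Digraph_Component.connected (with_proj M.graph)"
      using m(2) by (intro M.connected_graph) simp
    ultimately have "M.graph \<in> conn_graphs n e"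
      by (simp add: conn_graphs_def V M.is_pair_graph)
    moreover have "labelled_graph.balanced M.graph n" using M.balanced_graph by (simp add: n)
    ultimately show thesis by (rule that)
  qed
  have "rho_min n e = l"
    unfolding rho_min_def
  proof (rule Min_eqI)
    show "finite (rho ` conn_graphs n e)" by (simp add: finite_conn_graphs)
    show "l \<in> rho ` conn_graphs n e" using G rho_eq by (metis imageI)
  qed (use rho_ge in blast)
  \<comment> \<open>Minimizing now means \<open>rho G = l\<close>, which \<open>rho_eq\<close> and
    \<open>bal\<close> translate into the join form.\<close>
  then show ?thesis
    unfolding minimizers_def m(4) m_def[symmetric] l_def[symmetric] using rho_eq bal by auto
qed

end
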